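(* A function $\varphi\in C^{\infty}(\mathbb{R})$ is a symbol for $S(\mathbb{R})$ if and only if the following two conditions are satisfied: (i) For all $j\in \mathbb{N}_0$ there exist $C,p>0$ such that $|\varphi^{(j)}(x)|\leq C(1+|\varphi(x)|^2)^p$ for every $x\in\mathbb{R}$. (ii) There exists $k>0$ such that $|\varphi(x)|\geq |x|^{1/k}$ for all $|x|\geq k$.
   Context: All functions are real-valued and $C^\infty(\mathbb{R})$ is the space of smooth functions $\mathbb{R}\to\mathbb{R}$. $S(\mathbb{R})$ is the (real) Schwartz space of smooth functions $f:\mathbb{R}\to\mathbb{R}$ such that $\pi_n(f):=\sup_{x\in \mathbb{R}}\sup_{0\leq j\leq n}(1+|x|^2)^n|f^{(j)}(x)|<\infty$ for each $n\in\mathbb{N}$. A function $\varphi\in C^\infty(\mathbb{R})$ is called a symbol for $S(\mathbb{R})$ if $f\circ\varphi\in S(\mathbb{R})$ whenever $f\in S(\mathbb{R})$. $\mathbb{N}_0=\mathbb{N}\cup\{0\}$. *)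

theory Defs
  imports "HOL-Analysis.Analysis"
begin

text \<open>The \<open>j\<close>-th derivative of \<open>f\<close> is \<open>(deriv ^^ j) f\<close>. Since \<open>deriv\<close> is total, it is meaningful
  only because smoothness demands that every iterate be differentiable everywhere.\<close>

definition smooth_functions :: "(real \<Rightarrow> real) set" where
  "smooth_functions = {f. \<forall>n x. (deriv ^^ n) f field_differentiable at x}"

text \<open>The suprema are taken in the extended reals, so that an unbounded family has supremum
  \<open>\<infinity>\<close> and finiteness is a genuine condition.\<close>

definition schwartz_seminorm :: "nat \<Rightarrow> (real \<Rightarrow> real) \<Rightarrow> ereal" where
  "schwartz_seminorm n f =
     (SUP x. SUP j\<in>{0..n}. ereal ((1 + \<bar>x\<bar>\<^sup>2) ^ n * \<bar>(deriv ^^ j) f x\<bar>))"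

definition schwartz_space :: "(real \<Rightarrow> real) set" where
  "schwartz_space = {f \<in> smooth_functions. \<forall>n\<ge>1. schwartz_seminorm n f < \<infinity>}"

definition schwartz_symbol :: "(real \<Rightarrow> real) \<Rightarrow> bool" where
  "schwartz_symbol \<phi> \<longleftrightarrow>
     \<phi> \<in> smooth_functions \<and> (\<forall>f\<in>schwartz_space. f \<circ> \<phi> \<in> schwartz_space)"

end

(*
Conditions (i) and (ii) both say that a function g, namely a derivative of phi or the identity, is
dominated by a power of 1 + phi^2. If they hold, differentiating f o phi produces sums of products
of slowly growing factors with the rapidly decreasing functions f^(i) o phi. If the bound fails
for g, there are points y_m with |g(y_m)| > m (1 + phi(y_m)^2)^m. A sum of bumps centred at phi(y_m)
of height (1 + phi(y_m)^2)^(-m) is then a Schwartz function, and composing it with phi gives at y_m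
a value, or a derivative, too large for a Schwartz function.
*)
theory Submission
  imports Defs
begin

text \<open>Two difficulties shape the proof. Explicit formulas for higher derivatives of products,
  composites and quotients are unwieldy, so statements about iterated \<open>deriv\<close> are
  proved for a family that differentiation maps into itself, and only first-order rules are ever
  applied. Condition (ii) has no multiplicative constant, unlike (i). It still amounts to domination
  of the identity by a power of 1 + \<phi>^2, because its single parameter \<open>k\<close> is both
  a threshold and an exponent, and enlarging it absorbs any constant.\<close>

section \<open>Smooth functions\<close>

text \<open>Smoothness is the largest property that implies differentiability and is inherited by
  \<open>deriv\<close>. A family \<open>S\<close> stable under \<open>deriv\<close> therefore
  replaces formulas for the n-th derivative.\<close>

lemma smooth_coinduct:
  assumes "f \<in> S"
    and diff: "\<And>f x. f \<in> S \<Longrightarrow> f field_differentiable at x"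
    and deriv: "\<And>f. f \<in> S \<Longrightarrow> deriv f \<in> S"
  shows "f \<in> smooth_functions"
proof -
  have "(deriv ^^ n) f \<in> S" for n
    by (induction n) (auto simp: assms)
  then show ?thesis
    using diff by (auto simp: smooth_functions_def)
qed

lemma smooth_field_differentiable:
  assumes "f \<in> smooth_functions"
  shows "f field_differentiable at x"
  using assms unfolding smooth_functions_def by (auto dest: spec[of _ 0])

lemma smooth_has_derivative:
  assumes "f \<in> smooth_functions"
  shows "(f has_real_derivative deriv f x) (at x)"
  using assms field_differentiable_derivI smooth_field_differentiable by blast

lemma smooth_deriv:
  assumes "f \<in> smooth_functions"
  shows "deriv f \<in> smooth_functions"
proof -
  have "(deriv ^^ n) (deriv f) field_differentiable at x" for n x
    using assms unfolding smooth_functions_def mem_Collect_eq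
    by (metis comp_apply funpow_Suc_right)
  then show ?thesis
    by (simp add: smooth_functions_def)
qed

lemma smooth_higher_deriv:
  "f \<in> smooth_functions \<Longrightarrow> (deriv ^^ n) f \<in> smooth_functions"
  by (induction n) (auto simp: smooth_deriv)

lemma smooth_continuous_on:
  "f \<in> smooth_functions \<Longrightarrow> continuous_on A f"
  by (intro continuous_at_imp_continuous_on ballI
      field_differentiable_imp_continuous_at smooth_field_differentiable)

lemma smooth_affine: "(\<lambda>x. a * x + b) \<in> smooth_functions"
proof (rule smooth_coinduct[where S = "{f. \<exists>a b. f = (\<lambda>x. a * x + b)}"])
  have *: "((\<lambda>x. a * x + b) has_real_derivative a) (at x)" for a b x
    by (auto intro!: derivative_eq_intros)
  show "f field_differentiable at x" if "f \<in> {f. \<exists>a b. f = (\<lambda>x. a * x + b)}" for f and x :: real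
    using that by (auto simp: field_differentiable_def intro: *)
  have "deriv (\<lambda>x. a * x + b) = (\<lambda>x. 0 * x + a)" for a b
    using *[THEN DERIV_imp_deriv] by (intro ext) simp
  then show "deriv f \<in> {f. \<exists>a b. f = (\<lambda>x. a * x + b)}" if "f \<in> {f. \<exists>a b. f = (\<lambda>x. a * x + b)}" for f
    using that by blast
qed auto

lemma smooth_const: "(\<lambda>x. b) \<in> smooth_functions"
  using smooth_affine[of 0 b] by simp

lemma smooth_ident: "(\<lambda>x. x) \<in> smooth_functions"
  using smooth_affine[of 1 0] by simp

text \<open>The derivative of a product, composite or reciprocal mixes these operations. Closing
  under all of them at once gives a set that \<open>deriv\<close> preserves, as
  \<open>smooth_coinduct\<close> requires.\<close>

inductive_set smooth_closure :: "(real \<Rightarrow> real) set" where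
  base: "f \<in> smooth_functions \<Longrightarrow> f \<in> smooth_closure"
| add: "f \<in> smooth_closure \<Longrightarrow> g \<in> smooth_closure \<Longrightarrow> (\<lambda>x. f x + g x) \<in> smooth_closure"
| mult: "f \<in> smooth_closure \<Longrightarrow> g \<in> smooth_closure \<Longrightarrow> (\<lambda>x. f x * g x) \<in> smooth_closure"
| comp: "f \<in> smooth_closure \<Longrightarrow> g \<in> smooth_closure \<Longrightarrow> (\<lambda>x. f (g x)) \<in> smooth_closure"
| inverse: "f \<in> smooth_closure \<Longrightarrow> (\<And>x. f x \<noteq> 0) \<Longrightarrow> (\<lambda>x. inverse (f x)) \<in> smooth_closure"

lemma smooth_closure_deriv:
  assumes "f \<in> smooth_closure"
  shows "(\<forall>x. (f has_real_derivative deriv f x) (at x)) \<and> deriv f \<in> smooth_closure"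
proof -
  have *: "(\<forall>x. (f has_real_derivative deriv f x) (at x)) \<and> deriv f \<in> smooth_closure"
    if D: "\<And>x. (f has_real_derivative f' x) (at x)" and "f' \<in> smooth_closure" for f f'
  proof -
    have "deriv f = f'"
      using D by (intro ext DERIV_imp_deriv)
    then show ?thesis
      using that by auto
  qed
  show ?thesis
    using assms
  proof induction
    case (base f)
    then show ?case
      using smooth_has_derivative smooth_deriv smooth_closure.base by blast
  next
    case (add f g)
    show ?case
      by (rule *[of _ "\<lambda>x. deriv f x + deriv g x"])
        (use add in \<open>auto intro!: DERIV_add smooth_closure.add\<close>)
  next
    case (mult f g)
    show ?case
      by (rule *[of _ "\<lambda>x. deriv f x * g x + deriv g x * f x"])
        (use mult in \<open>auto intro!: DERIV_mult smooth_closure.add smooth_closure.mult\<close>)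
  next
    case (comp f g)
    have "((\<lambda>x. f (g x)) has_real_derivative deriv f (g x) * deriv g x) (at x)" for x
      by (rule DERIV_chain2[of f]) (use comp in auto)
    moreover have "(\<lambda>x. deriv f (g x) * deriv g x) \<in> smooth_closure"
      by (rule smooth_closure.mult[OF smooth_closure.comp[of "deriv f"]]) (use comp in auto)
    ultimately show ?case
      by (rule *)
  next
    case (inverse f)
    let ?h = "\<lambda>x. inverse (f x)"
    \<comment> \<open>The minus sign is written as a factor so that the derivative uses only
      operations of \<open>smooth_closure\<close>.\<close>
    have "((\<lambda>x. inverse (f x)) has_real_derivative (-1) * (?h x * deriv f x * ?h x)) (at x)" for x
      using DERIV_inverse'[of f "deriv f x" x UNIV] inverse by simp
    moreover have h: "?h \<in> smooth_closure"
      by (rule smooth_closure.inverse) (use inverse in auto)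
    have "(\<lambda>x. (-1) * (?h x * deriv f x * ?h x)) \<in> smooth_closure"
      by (rule smooth_closure.mult[OF smooth_closure.base[OF smooth_const]
            smooth_closure.mult[OF smooth_closure.mult]])
        (use inverse h in auto)
    ultimately show ?case
      by (rule *)
  qed
qed

lemma smooth_closure_smooth: "f \<in> smooth_closure \<Longrightarrow> f \<in> smooth_functions"
  by (rule smooth_coinduct[of _ smooth_closure])
    (use smooth_closure_deriv in \<open>auto simp: field_differentiable_def\<close>)

lemma smooth_add:
  "f \<in> smooth_functions \<Longrightarrow> g \<in> smooth_functions \<Longrightarrow> (\<lambda>x. f x + g x) \<in> smooth_functions"
  by (rule smooth_closure_smooth[OF smooth_closure.add[OF smooth_closure.base smooth_closure.base]])

lemma smooth_mult:
  "f \<in> smooth_functions \<Longrightarrow> g \<in> smooth_functions \<Longrightarrow> (\<lambda>x. f x * g x) \<in> smooth_functions"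
  by (rule smooth_closure_smooth[OF smooth_closure.mult[OF smooth_closure.base smooth_closure.base]])

lemma smooth_compose:
  "f \<in> smooth_functions \<Longrightarrow> g \<in> smooth_functions \<Longrightarrow> (\<lambda>x. f (g x)) \<in> smooth_functions"
  by (rule smooth_closure_smooth[OF smooth_closure.comp[OF smooth_closure.base smooth_closure.base]])

lemma smooth_inverse:
  "f \<in> smooth_functions \<Longrightarrow> (\<And>x. f x \<noteq> 0) \<Longrightarrow> (\<lambda>x. inverse (f x)) \<in> smooth_functions"
  by (rule smooth_closure_smooth[OF smooth_closure.inverse[OF smooth_closure.base]])

lemma deriv_mult_smooth:
  assumes "f \<in> smooth_functions" "g \<in> smooth_functions"
  shows "deriv (\<lambda>x. f x * g x) = (\<lambda>x. deriv f x * g x + f x * deriv g x)"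
  by (intro ext DERIV_imp_deriv)
    (auto intro!: derivative_eq_intros smooth_has_derivative assms)

lemma deriv_compose_smooth:
  assumes "f \<in> smooth_functions" "g \<in> smooth_functions"
  shows "deriv (\<lambda>x. f (g x)) = (\<lambda>x. deriv f (g x) * deriv g x)"
  by (intro ext DERIV_imp_deriv DERIV_chain2[of f] smooth_has_derivative assms)

section \<open>Higher derivatives of sums and translates, and their locality\<close>

lemma higher_deriv_add:
  assumes "f \<in> smooth_functions" "g \<in> smooth_functions"
  shows "(deriv ^^ n) (\<lambda>x. f x + g x) = (\<lambda>x. (deriv ^^ n) f x + (deriv ^^ n) g x)"
proof (induction n)
  case (Suc n)
  have "deriv (\<lambda>x. (deriv ^^ n) f x + (deriv ^^ n) g x) = (\<lambda>x. deriv ((deriv ^^ n) f) x + deriv ((deriv ^^ n) g) x)"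
    by (intro ext DERIV_imp_deriv DERIV_add smooth_has_derivative smooth_higher_deriv assms)
  then show ?case
    by (simp add: Suc)
qed auto

lemma higher_deriv_shift:
  assumes "f \<in> smooth_functions"
  shows "(deriv ^^ n) (\<lambda>x. c * f (x - a)) = (\<lambda>x. c * (deriv ^^ n) f (x - a))"
proof (induction n)
  case (Suc n)
  have "((\<lambda>x. c * (deriv ^^ n) f (x - a)) has_real_derivative c * deriv ((deriv ^^ n) f) (x - a)) (at x)" for x
    using smooth_has_derivative[OF smooth_higher_deriv[OF assms, of n], of "x - a"]
    by (intro DERIV_cmult) (auto simp: DERIV_shift[of _ _ _ "-a", simplified])
  then have "deriv (\<lambda>x. c * (deriv ^^ n) f (x - a)) = (\<lambda>x. c * deriv ((deriv ^^ n) f) (x - a))"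
    by (intro ext DERIV_imp_deriv)
  then show ?case
    by (simp add: Suc)
qed auto

lemma higher_deriv_cong_open:
  assumes "open U" "\<And>x. x \<in> U \<Longrightarrow> f x = g x" "x \<in> U"
  shows "(deriv ^^ n) f x = (deriv ^^ n) g x"
  using assms(3)
proof (induction n arbitrary: x)
  case (Suc n)
  then have "\<forall>\<^sub>F y in nhds x. (deriv ^^ n) f y = (deriv ^^ n) g y"
    using assms(1) by (auto simp: eventually_nhds)
  then show ?case
    using Suc by (simp add: deriv_cong_ev)
qed (simp add: assms)

text \<open>This makes functions glued from local pieces smooth, without differentiating an infinite
  sum of bumps term by term.\<close>

lemma smooth_local:
  assumes "\<And>x. \<exists>g\<in>smooth_functions. \<forall>\<^sub>F y in nhds x. f y = g y"
  shows "f \<in> smooth_functions"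
  unfolding smooth_functions_def
proof safe
  fix n x
  obtain g where g: "g \<in> smooth_functions" "\<forall>\<^sub>F y in nhds x. f y = g y"
    using assms by blast
  obtain U where U: "open U" "x \<in> U" "\<And>y. y \<in> U \<Longrightarrow> f y = g y"
    using g(2) by (auto simp: eventually_nhds)
  have "((deriv ^^ n) g has_real_derivative deriv ((deriv ^^ n) g) x) (at x)"
    using g smooth_higher_deriv smooth_has_derivative by blast
  then have "((deriv ^^ n) f has_real_derivative deriv ((deriv ^^ n) g) x) (at x)"
    by (rule has_field_derivative_transform_within_open)
      (use U higher_deriv_cong_open[of U f g] in auto)
  then show "(deriv ^^ n) f field_differentiable at x"
    by (auto simp: field_differentiable_def)
qed

section \<open>Smooth cut-off functions built from exp(-1/x)\<close>

lemma poly_times_exp_tendsto_0: "((\<lambda>u::real. poly p u * exp (- u)) \<longlongrightarrow> 0) at_top"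
proof -
  have "((\<lambda>u::real. \<Sum>i\<le>degree p. coeff p i * (u ^ i / exp u)) \<longlongrightarrow> (\<Sum>i\<le>degree p. coeff p i * 0)) at_top"
    by (intro tendsto_intros tendsto_power_div_exp_0)
  then show ?thesis
    by (simp add: poly_altdef exp_minus sum_distrib_right divide_inverse mult.assoc)
qed

text \<open>For \<open>p = 1\<close> this is the classical flat function exp(-1/x). The polynomial
  parameter makes the family stable under differentiation: with u = 1/x, the derivative of p(u)
  exp(-u) in x is u^2 (p - p')(u) exp(-u).\<close>

definition flat_exp :: "real poly \<Rightarrow> real \<Rightarrow> real" where
  "flat_exp p x = (if x \<le> 0 then 0 else poly p (inverse x) * exp (- inverse x))"

lemma flat_exp_has_derivative:
  "(flat_exp p has_real_derivative flat_exp (monom 1 2 * (p - pderiv p)) x) (at x)"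
proof (cases x "0 :: real" rule: linorder_cases)
  case less
  have "((\<lambda>x. 0) has_real_derivative 0) (at x)"
    by simp
  then have "(flat_exp p has_real_derivative 0) (at x)"
    by (rule has_field_derivative_transform_within_open[of _ _ _ "{..<0}"])
      (use less in \<open>auto simp: flat_exp_def\<close>)
  then show ?thesis
    using less by (simp add: flat_exp_def)
next
  case greater
  have "((\<lambda>x. poly p (inverse x) * exp (- inverse x)) has_real_derivative
      flat_exp (monom 1 2 * (p - pderiv p)) x) (at x)"
    using greater
    by (auto intro!: derivative_eq_intros DERIV_chain2[OF poly_DERIV]
        simp: flat_exp_def poly_monom power2_eq_square algebra_simps)
  then show ?thesis
    by (rule has_field_derivative_transform_within_open[of _ _ _ "{0<..}"])
      (use greater in \<open>auto simp: flat_exp_def\<close>)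
next
  case equal
  \<comment> \<open>\<open>pCons 0 p\<close> is X times p; the extra factor 1/h is the denominator
    of the difference quotient at 0.\<close>
  have "((\<lambda>h. poly (pCons 0 p) (inverse h) * exp (- inverse h)) \<longlongrightarrow> 0) (at_right (0::real))"
    by (rule filterlim_compose[OF poly_times_exp_tendsto_0 filterlim_inverse_at_top_right])
  then have "((\<lambda>h. flat_exp p h / h) \<longlongrightarrow> 0) (at_right 0)"
    by (rule Lim_transform_eventually)
      (auto simp: eventually_at_filter flat_exp_def divide_inverse)
  moreover have "((\<lambda>h. flat_exp p h / h) \<longlongrightarrow> 0) (at_left 0)"
    by (rule Lim_transform_eventually[OF tendsto_const])
      (auto simp: eventually_at_filter flat_exp_def)
  ultimately have "((\<lambda>h. flat_exp p h / h) \<longlongrightarrow> 0) (at 0)"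
    by (simp add: filterlim_split_at)
  then show ?thesis
    using equal by (simp add: DERIV_def flat_exp_def)
qed

lemma smooth_flat_exp: "flat_exp p \<in> smooth_functions"
proof (rule smooth_coinduct[of _ "range flat_exp"])
  show "f field_differentiable at x" if "f \<in> range flat_exp" for f x
    using that flat_exp_has_derivative by (auto simp: field_differentiable_def)
  have "deriv (flat_exp p) = flat_exp (monom 1 2 * (p - pderiv p))" for p
    by (intro ext DERIV_imp_deriv flat_exp_has_derivative)
  then show "deriv f \<in> range flat_exp" if "f \<in> range flat_exp" for f
    using that by auto
qed auto

text \<open>The classical quotient E(x) / (E(x) + E(1 - x)) works: x and 1 - x are never both
  nonpositive, so the denominator does not vanish.\<close>

lemma smooth_step_exists:
  obtains S where "S \<in> smooth_functions" "\<And>x. x \<le> 0 \<Longrightarrow> S x = 0" "\<And>x. x \<ge> 1 \<Longrightarrow> S x = 1"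
proof -
  define E where "E = flat_exp 1"
  have E: "E \<in> smooth_functions" "E x \<ge> 0" "E x = 0 \<longleftrightarrow> x \<le> 0" for x
    by (auto simp: E_def smooth_flat_exp) (auto simp: flat_exp_def split: if_splits)
  have nz: "E x + E ((-1) * x + 1) \<noteq> 0" for x
  proof
    assume "E x + E ((-1) * x + 1) = 0"
    then have "E x = 0" "E ((-1) * x + 1) = 0"
      using E(2) by (simp_all add: add_nonneg_eq_0_iff)
    then show False
      unfolding E(3) by linarith
  qed
  define S where "S = (\<lambda>x. E x * inverse (E x + E ((-1) * x + 1)))"
  have "(\<lambda>x. E ((-1) * x + 1)) \<in> smooth_functions"
    by (rule smooth_compose[OF E(1) smooth_affine])
  then have "S \<in> smooth_functions"
    unfolding S_def by (rule smooth_mult[OF E(1) smooth_inverse[OF smooth_add[OF E(1)] nz]])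
  moreover have "S x = 0" if "x \<le> 0" for x
    using that E(3)[of x] by (simp add: S_def)
  moreover have "S x = 1" if "x \<ge> 1" for x
    using that E(3)[of "(-1) * x + 1"] E(3)[of x] by (simp add: S_def)
  ultimately show thesis
    by (rule that)
qed

text \<open>Take the product of a step rising on [-(r+1), -r] and its mirror image falling on
  [r, r+1].\<close>

lemma smooth_plateau_exists:
  obtains P where "P \<in> smooth_functions" "\<And>x. \<bar>x\<bar> \<le> r \<Longrightarrow> P x = 1" "\<And>x. \<bar>x\<bar> \<ge> r + 1 \<Longrightarrow> P x = 0"
proof -
  obtain S where S: "S \<in> smooth_functions" "\<And>x. x \<le> 0 \<Longrightarrow> S x = 0" "\<And>x. x \<ge> 1 \<Longrightarrow> S x = 1"
    using smooth_step_exists by metis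
  show thesis
  proof
    show "(\<lambda>x. S (1 * x + (r + 1)) * S ((-1) * x + (r + 1))) \<in> smooth_functions"
      by (intro smooth_mult smooth_compose[OF S(1)] smooth_affine)
    show "S (1 * x + (r + 1)) * S ((-1) * x + (r + 1)) = 1" if "\<bar>x\<bar> \<le> r" for x
      using that S(3) by auto
    show "S (1 * x + (r + 1)) * S ((-1) * x + (r + 1)) = 0" if "\<bar>x\<bar> \<ge> r + 1" for x
      using that S(2)[of "x + (r + 1)"] S(2)[of "-x + (r + 1)"] by (cases "x \<ge> 0") auto
  qed
qed

section \<open>Sufficiency\<close>

lemma higher_deriv_const: "(deriv ^^ n) (\<lambda>x::real. c :: real) = (\<lambda>x. if n = 0 then c else 0)"
  by (induction n) auto

text \<open>The seminorm ties the weight to the order of the derivative; here they vary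
  independently. A large seminorm index dominates both, and conversely each seminorm involves
  finitely many orders.\<close>

lemma schwartz_space_iff:
  "f \<in> schwartz_space \<longleftrightarrow> f \<in> smooth_functions \<and>
    (\<forall>n j. \<exists>C. \<forall>x. (1 + x\<^sup>2) ^ n * \<bar>(deriv ^^ j) f x\<bar> \<le> C)"
proof (intro iffI conjI allI)
  fix n j
  assume f: "f \<in> schwartz_space"
  then show "f \<in> smooth_functions"
    by (simp add: schwartz_space_def)
  \<comment> \<open>The successor is taken because \<open>schwartz_space\<close> controls only
    indices from 1 on.\<close>
  define m where "m = Suc (max n j)"
  have "schwartz_seminorm m f < \<infinity>"
    using f by (auto simp: schwartz_space_def m_def)
  then obtain C where "schwartz_seminorm m f \<le> ereal C"
    by (cases "schwartz_seminorm m f") auto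
  then have C: "(1 + x\<^sup>2) ^ m * \<bar>(deriv ^^ j) f x\<bar> \<le> C" for x
    by (auto simp: schwartz_seminorm_def SUP_le_iff m_def)
  have "(1 + x\<^sup>2) ^ n * \<bar>(deriv ^^ j) f x\<bar> \<le> (1 + x\<^sup>2) ^ m * \<bar>(deriv ^^ j) f x\<bar>" for x
    by (intro mult_right_mono power_increasing) (auto simp: m_def)
  with C show "\<exists>C. \<forall>x. (1 + x\<^sup>2) ^ n * \<bar>(deriv ^^ j) f x\<bar> \<le> C"
    by (meson order_trans)
next
  assume *: "f \<in> smooth_functions \<and> (\<forall>n j. \<exists>C. \<forall>x. (1 + x\<^sup>2) ^ n * \<bar>(deriv ^^ j) f x\<bar> \<le> C)"
  have "schwartz_seminorm n f < \<infinity>" for n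
  proof -
    obtain C where C: "\<And>j x. (1 + x\<^sup>2) ^ n * \<bar>(deriv ^^ j) f x\<bar> \<le> C j"
      using * by metis
    have "schwartz_seminorm n f \<le> ereal (Max (C ` {0..n}))"
      unfolding schwartz_seminorm_def
      by (auto intro!: SUP_least order_trans[OF C] Max_ge)
    then show ?thesis
      by auto
  qed
  with * show "f \<in> schwartz_space"
    by (simp add: schwartz_space_def)
qed

lemma schwartz_deriv:
  assumes "f \<in> schwartz_space"
  shows "deriv f \<in> schwartz_space"
proof -
  have "\<exists>C. \<forall>x. (1 + x\<^sup>2) ^ n * \<bar>(deriv ^^ j) (deriv f) x\<bar> \<le> C" for n j
  proof -
    have "\<exists>C. \<forall>x. (1 + x\<^sup>2) ^ n * \<bar>(deriv ^^ Suc j) f x\<bar> \<le> C"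
      using assms by (subst (asm) schwartz_space_iff) blast
    then show ?thesis
      by (simp only: funpow_Suc_right o_apply)
  qed
  then show ?thesis
    using assms schwartz_space_iff smooth_deriv by blast
qed

text \<open>Natural exponents and a constant of any sign keep the algebra simple. As the base is at
  least 1, both can be enlarged, which gives the version with positive real parameters.\<close>

definition poly_bounded :: "(real \<Rightarrow> real) \<Rightarrow> (real \<Rightarrow> real) \<Rightarrow> bool" where
  "poly_bounded \<phi> g \<longleftrightarrow> (\<exists>(C::real) (N::nat). \<forall>x. \<bar>g x\<bar> \<le> C * (1 + (\<phi> x)\<^sup>2) ^ N)"

lemma poly_boundedE:
  assumes "poly_bounded \<phi> g"
  obtains C N where "C > 0" "N > 0" "\<And>x. \<bar>g x\<bar> \<le> C * (1 + (\<phi> x)\<^sup>2) ^ N"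
proof -
  obtain C N where CN: "\<And>x. \<bar>g x\<bar> \<le> C * (1 + (\<phi> x)\<^sup>2) ^ N"
    using assms by (auto simp: poly_bounded_def)
  have "\<bar>g x\<bar> \<le> (\<bar>C\<bar> + 1) * (1 + (\<phi> x)\<^sup>2) ^ (N + 1)" for x
    by (rule order_trans[OF CN]) (intro mult_mono power_increasing, auto)
  then show thesis
    by (intro that[of "\<bar>C\<bar> + 1" "N + 1"]) auto
qed

lemma poly_bounded_iff_powr:
  "poly_bounded \<phi> g \<longleftrightarrow>
    (\<exists>C p :: real. C > 0 \<and> p > 0 \<and> (\<forall>x. \<bar>g x\<bar> \<le> C * (1 + \<bar>\<phi> x\<bar>\<^sup>2) powr p))"
proof
  assume "poly_bounded \<phi> g"
  then obtain C N where "C > 0" "N > 0" "\<And>x. \<bar>g x\<bar> \<le> C * (1 + (\<phi> x)\<^sup>2) ^ N"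
    using poly_boundedE by metis
  then show "\<exists>C p :: real. C > 0 \<and> p > 0 \<and> (\<forall>x. \<bar>g x\<bar> \<le> C * (1 + \<bar>\<phi> x\<bar>\<^sup>2) powr p)"
    by (intro exI[of _ C] exI[of _ "real N"]) (simp add: powr_realpow add_pos_nonneg)
next
  assume "\<exists>C p :: real. C > 0 \<and> p > 0 \<and> (\<forall>x. \<bar>g x\<bar> \<le> C * (1 + \<bar>\<phi> x\<bar>\<^sup>2) powr p)"
  then obtain C p :: real where C: "C > 0" "\<And>x. \<bar>g x\<bar> \<le> C * (1 + \<bar>\<phi> x\<bar>\<^sup>2) powr p"
    by blast
  obtain N where N: "p \<le> real N"
    using real_arch_simple by blast
  have "\<bar>g x\<bar> \<le> C * (1 + (\<phi> x)\<^sup>2) ^ N" for x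
  proof (rule order_trans[OF C(2)])
    have "(1 + \<bar>\<phi> x\<bar>\<^sup>2) powr p \<le> (1 + (\<phi> x)\<^sup>2) powr (real N)"
      using N by (simp add: powr_mono)
    then show "C * (1 + \<bar>\<phi> x\<bar>\<^sup>2) powr p \<le> C * (1 + (\<phi> x)\<^sup>2) ^ N"
      using C(1) by (simp add: powr_realpow add_pos_nonneg)
  qed
  then show "poly_bounded \<phi> g"
    by (auto simp: poly_bounded_def)
qed

lemma poly_bounded_mult:
  assumes "poly_bounded \<phi> g" "poly_bounded \<phi> h"
  shows "poly_bounded \<phi> (\<lambda>x. g x * h x)"
proof -
  obtain C N where g: "C > 0" "N > 0" "\<And>x. \<bar>g x\<bar> \<le> C * (1 + (\<phi> x)\<^sup>2) ^ N"
    using poly_boundedE[OF assms(1)] by metis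
  obtain D M where h: "D > 0" "M > 0" "\<And>x. \<bar>h x\<bar> \<le> D * (1 + (\<phi> x)\<^sup>2) ^ M"
    using poly_boundedE[OF assms(2)] by metis
  have "\<bar>g x * h x\<bar> \<le> (C * D) * (1 + (\<phi> x)\<^sup>2) ^ (N + M)" for x
  proof -
    have "\<bar>g x * h x\<bar> \<le> (C * (1 + (\<phi> x)\<^sup>2) ^ N) * (D * (1 + (\<phi> x)\<^sup>2) ^ M)"
      unfolding abs_mult using g h by (intro mult_mono) auto
    then show ?thesis
      by (simp add: power_add mult_ac)
  qed
  then show ?thesis
    unfolding poly_bounded_def by blast
qed

lemma poly_bounded_add:
  assumes "poly_bounded \<phi> g" "poly_bounded \<phi> h"
  shows "poly_bounded \<phi> (\<lambda>x. g x + h x)"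
proof -
  obtain C N where g: "C > 0" "N > 0" "\<And>x. \<bar>g x\<bar> \<le> C * (1 + (\<phi> x)\<^sup>2) ^ N"
    using poly_boundedE[OF assms(1)] by metis
  obtain D M where h: "D > 0" "M > 0" "\<And>x. \<bar>h x\<bar> \<le> D * (1 + (\<phi> x)\<^sup>2) ^ M"
    using poly_boundedE[OF assms(2)] by metis
  have "\<bar>g x + h x\<bar> \<le> (C + D) * (1 + (\<phi> x)\<^sup>2) ^ (N + M)" for x
  proof -
    have "C * (1 + (\<phi> x)\<^sup>2) ^ N \<le> C * (1 + (\<phi> x)\<^sup>2) ^ (N + M)"
      "D * (1 + (\<phi> x)\<^sup>2) ^ M \<le> D * (1 + (\<phi> x)\<^sup>2) ^ (N + M)"
      using g(1) h(1) by (auto intro!: mult_left_mono power_increasing)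
    then show ?thesis
      using g(3)[of x] h(3)[of x] by (simp add: distrib_right)
  qed
  then show ?thesis
    unfolding poly_bounded_def by blast
qed

text \<open>The induction varies \<open>f\<close> and \<open>g\<close>: (f g)' = f' g + f g' is a
  sum of two products satisfying the same hypotheses, so Leibniz's formula is avoided.\<close>

lemma poly_bounded_higher_deriv_mult:
  assumes "f \<in> smooth_functions" "g \<in> smooth_functions"
    and "\<And>j. poly_bounded \<phi> ((deriv ^^ j) f)" "\<And>j. poly_bounded \<phi> ((deriv ^^ j) g)"
  shows "poly_bounded \<phi> ((deriv ^^ n) (\<lambda>x. f x * g x))"
  using assms
proof (induction n arbitrary: f g)
  case 0
  then show ?case
    using poly_bounded_mult[of \<phi> f g] 0(3,4)[of 0] by simp
next
  case (Suc n)
  have d: "poly_bounded \<phi> ((deriv ^^ j) (deriv f))" "poly_bounded \<phi> ((deriv ^^ j) (deriv g))" for j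
    using Suc.prems(3,4)[of "Suc j"] by (simp_all only: funpow_Suc_right o_apply)
  show ?case
    using Suc.prems
    by (simp only: funpow_Suc_right o_apply deriv_mult_smooth higher_deriv_add smooth_mult smooth_deriv)
      (intro poly_bounded_add Suc.IH smooth_deriv d)
qed

text \<open>The factor \<open>h\<close> makes the induction on \<open>n\<close> go through without Faa di Bruno's formula: the
  derivative of \<open>h (f \<circ> \<phi>)\<close> is \<open>h' (f \<circ> \<phi>) + (h \<phi>') (f' \<circ> \<phi>)\<close>.\<close>

lemma decay_higher_deriv_mult_compose:
  assumes \<phi>: "\<phi> \<in> smooth_functions" "\<And>j. poly_bounded \<phi> ((deriv ^^ j) \<phi>)" "poly_bounded \<phi> (\<lambda>x. x)"
    and "h \<in> smooth_functions" "\<And>j. poly_bounded \<phi> ((deriv ^^ j) h)" "f \<in> schwartz_space"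
  shows "\<exists>C. \<forall>x. (1 + x\<^sup>2) ^ m * \<bar>(deriv ^^ n) (\<lambda>x. h x * f (\<phi> x)) x\<bar> \<le> C"
  using assms(4-)
proof (induction n arbitrary: h f)
  case 0
  obtain C N where h: "C > 0" "N > 0" "\<And>x. \<bar>h x\<bar> \<le> C * (1 + (\<phi> x)\<^sup>2) ^ N"
    using poly_boundedE 0(2)[of 0] by (metis funpow_0)
  obtain D M where D: "D > 0" "M > 0" "\<And>x. \<bar>x\<bar> \<le> D * (1 + (\<phi> x)\<^sup>2) ^ M"
    using poly_boundedE[OF \<phi>(3)] by metis
  \<comment> \<open>With w = 1 + \<phi>(x)^2, the weight (1 + x^2)^m costs 2 M m powers of w and
    \<open>h\<close> costs N; the decay of \<open>f\<close> must pay for both.\<close>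
  define K where "K = 2 * M * m + N"
  obtain B where "\<forall>y. (1 + y\<^sup>2) ^ K * \<bar>(deriv ^^ 0) f y\<bar> \<le> B"
    using 0 unfolding schwartz_space_iff by blast
  then have B: "(1 + y\<^sup>2) ^ K * \<bar>f y\<bar> \<le> B" for y
    by simp
  have "(1 + x\<^sup>2) ^ m * \<bar>h x * f (\<phi> x)\<bar> \<le> (1 + D\<^sup>2) ^ m * C * B" for x
  proof -
    let ?w = "1 + (\<phi> x)\<^sup>2"
    have w: "?w ^ i \<ge> 1" for i
      by (rule one_le_power) simp
    have "x\<^sup>2 \<le> (D * ?w ^ M)\<^sup>2"
      using D(3)[of x] by (simp add: abs_le_square_iff[symmetric])
    then have "1 + x\<^sup>2 \<le> (1 + D\<^sup>2) * ?w ^ (2 * M)"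
      using w[of "2 * M"] by (simp add: power_mult_distrib power_mult[symmetric] mult.commute[of _ 2] distrib_right add_mono)
    then have "(1 + x\<^sup>2) ^ m \<le> ((1 + D\<^sup>2) * ?w ^ (2 * M)) ^ m"
      by (intro power_mono) auto
    also have "\<dots> = (1 + D\<^sup>2) ^ m * ?w ^ (2 * M * m)"
      by (simp add: power_mult_distrib power_mult)
    finally have "(1 + x\<^sup>2) ^ m * \<bar>h x * f (\<phi> x)\<bar>
        \<le> ((1 + D\<^sup>2) ^ m * ?w ^ (2 * M * m)) * ((C * ?w ^ N) * \<bar>f (\<phi> x)\<bar>)"
      unfolding abs_mult using h D(1) by (intro mult_mono) auto
    also have "\<dots> = ((1 + D\<^sup>2) ^ m * C) * (?w ^ K * \<bar>f (\<phi> x)\<bar>)"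
      by (simp add: K_def power_add mult_ac)
    also have "\<dots> \<le> ((1 + D\<^sup>2) ^ m * C) * B"
      using h(1) by (intro mult_left_mono B) auto
    finally show ?thesis .
  qed
  then show ?case
    by auto
next
  case (Suc n)
  note f = Suc.prems(3)
  have fs: "f \<in> smooth_functions"
    using f by (simp add: schwartz_space_iff)
  have dh: "poly_bounded \<phi> ((deriv ^^ j) (deriv h))" for j
    using Suc.prems(2)[of "Suc j"] by (simp only: funpow_Suc_right o_apply)
  have d\<phi>: "poly_bounded \<phi> ((deriv ^^ j) (deriv \<phi>))" for j
    using \<phi>(2)[of "Suc j"] by (simp only: funpow_Suc_right o_apply)
  have "deriv (\<lambda>x. h x * f (\<phi> x)) = (\<lambda>x. deriv h x * f (\<phi> x) + (h x * deriv \<phi> x) * deriv f (\<phi> x))"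
    using Suc.prems(1) fs \<phi>(1)
    by (simp add: deriv_mult_smooth deriv_compose_smooth smooth_compose mult_ac)
  then have eq: "(deriv ^^ Suc n) (\<lambda>x. h x * f (\<phi> x)) = (\<lambda>x. (deriv ^^ n) (\<lambda>x. deriv h x * f (\<phi> x)) x
      + (deriv ^^ n) (\<lambda>x. (h x * deriv \<phi> x) * deriv f (\<phi> x)) x)"
    using Suc.prems(1) fs \<phi>(1)
    by (simp only: funpow_Suc_right o_apply higher_deriv_add smooth_mult smooth_compose smooth_deriv)
  obtain C where C: "\<And>x. (1 + x\<^sup>2) ^ m * \<bar>(deriv ^^ n) (\<lambda>x. deriv h x * f (\<phi> x)) x\<bar> \<le> C"
    using Suc.IH[OF smooth_deriv[OF Suc.prems(1)] dh f] by blast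
  obtain D where D: "\<And>x. (1 + x\<^sup>2) ^ m * \<bar>(deriv ^^ n) (\<lambda>x. (h x * deriv \<phi> x) * deriv f (\<phi> x)) x\<bar> \<le> D"
    using Suc.IH[of "\<lambda>x. h x * deriv \<phi> x" "deriv f"] Suc.prems(1,2) \<phi>(1) f d\<phi>
      smooth_mult smooth_deriv schwartz_deriv poly_bounded_higher_deriv_mult[of h "deriv \<phi>"] by blast
  have "(1 + x\<^sup>2) ^ m * \<bar>(deriv ^^ Suc n) (\<lambda>x. h x * f (\<phi> x)) x\<bar> \<le> C + D" for x
  proof -
    have "(1 + x\<^sup>2) ^ m * \<bar>a + b\<bar> \<le> (1 + x\<^sup>2) ^ m * \<bar>a\<bar> + (1 + x\<^sup>2) ^ m * \<bar>b\<bar>" for a b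
      unfolding distrib_left[symmetric] by (intro mult_left_mono) auto
    then show ?thesis
      unfolding eq using C[of x] D[of x] by (meson add_mono order_trans)
  qed
  then show ?case
    by blast
qed

lemma schwartz_symbolI:
  assumes "\<phi> \<in> smooth_functions" "\<And>j. poly_bounded \<phi> ((deriv ^^ j) \<phi>)" "poly_bounded \<phi> (\<lambda>x. x)"
  shows "schwartz_symbol \<phi>"
  unfolding schwartz_symbol_def
proof safe
  fix f
  assume f: "f \<in> schwartz_space"
  have fs: "f \<in> smooth_functions"
    using f by (simp add: schwartz_space_iff)
  have "poly_bounded \<phi> ((deriv ^^ j) (\<lambda>x. 1))" for j
    unfolding poly_bounded_def by (intro exI[of _ 1] exI[of _ 0]) (auto simp: higher_deriv_const)
  from decay_higher_deriv_mult_compose[OF assms smooth_const this f]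
  show "f \<circ> \<phi> \<in> schwartz_space"
    by (simp add: schwartz_space_iff o_def smooth_compose[OF fs assms(1)])
qed (fact assms(1))

lemma abs_le_one_plus_square: "\<bar>x\<bar> \<le> 1 + x\<^sup>2" for x :: real
  using sum_squares_bound[of "\<bar>x\<bar>" 1] by simp

text \<open>For the direction to (ii), squaring the bound and cancelling one |x| \<ge> A^2 removes
  the constant A and doubles the exponent.\<close>

lemma poly_bounded_ident_iff:
  "poly_bounded \<phi> (\<lambda>x. x) \<longleftrightarrow> (\<exists>k::real. k > 0 \<and> (\<forall>x. \<bar>x\<bar> \<ge> k \<longrightarrow> \<bar>\<phi> x\<bar> \<ge> \<bar>x\<bar> powr (1 / k)))"
proof
  assume "poly_bounded \<phi> (\<lambda>x. x)"
  then obtain C N where C: "C > 0" "N > 0" "\<And>x. \<bar>x\<bar> \<le> C * (1 + (\<phi> x)\<^sup>2) ^ N"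
    using poly_boundedE by metis
  define A where "A = C * 2 ^ N"
  \<comment> \<open>4 N is the final exponent, A^2 pays for the constant after squaring, and k > A
    forces |\<phi> x| \<ge> 1, which permits 1 + \<phi>^2 \<le> 2 \<phi>^2.\<close>
  define k where "k = real (4 * N) + A\<^sup>2 + A"
  have A: "A > 0"
    using C by (simp add: A_def)
  have k: "k \<ge> 4 * N" "k \<ge> A\<^sup>2" "k > A" "k \<ge> 1"
    unfolding k_def using A C(2) zero_le_power2[of A] by linarith+
  have "\<bar>x\<bar> powr (1 / k) \<le> \<bar>\<phi> x\<bar>" if x: "\<bar>x\<bar> \<ge> k" for x
  proof -
    have ge1: "\<bar>\<phi> x\<bar> \<ge> 1"
    proof (rule ccontr)
      assume "\<not> \<bar>\<phi> x\<bar> \<ge> 1"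
      then have "(\<phi> x)\<^sup>2 \<le> 1"
        by (simp add: abs_square_le_1)
      then have "C * (1 + (\<phi> x)\<^sup>2) ^ N \<le> A"
        unfolding A_def using C(1) by (intro mult_left_mono power_mono) auto
      then show False
        using C(3)[of x] x k by linarith
    qed
    then have "1 + (\<phi> x)\<^sup>2 \<le> 2 * (\<phi> x)\<^sup>2"
      by (metis abs_1 abs_le_square_iff add_mono_thms_linordered_semiring(3) mult_2 one_power2)
    then have "C * (1 + (\<phi> x)\<^sup>2) ^ N \<le> C * (2 * (\<phi> x)\<^sup>2) ^ N"
      using C(1) by (intro mult_left_mono power_mono) auto
    also have "\<dots> = A * \<bar>\<phi> x\<bar> ^ (2 * N)"
      by (simp add: A_def power_mult_distrib power_mult)
    finally have "\<bar>x\<bar> \<le> A * \<bar>\<phi> x\<bar> ^ (2 * N)"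
      using C(3)[of x] by linarith
    then have "\<bar>x\<bar>\<^sup>2 \<le> (A * \<bar>\<phi> x\<bar> ^ (2 * N))\<^sup>2"
      by (intro power_mono) auto
    also have "\<dots> = A\<^sup>2 * \<bar>\<phi> x\<bar> ^ (4 * N)"
      by (simp add: power_mult_distrib power_mult[symmetric] mult.commute)
    also have "\<dots> \<le> \<bar>x\<bar> * \<bar>\<phi> x\<bar> ^ (4 * N)"
      using x k by (intro mult_right_mono) auto
    finally have "\<bar>x\<bar> \<le> \<bar>\<phi> x\<bar> ^ (4 * N)"
      unfolding power2_eq_square by (rule mult_left_le_imp_le) (use x k in linarith)
    also have "\<dots> = \<bar>\<phi> x\<bar> powr real (4 * N)"
      using ge1 by (subst powr_realpow) auto
    also have "\<dots> \<le> \<bar>\<phi> x\<bar> powr k"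
      using ge1 k by (intro powr_mono) auto
    finally have "\<bar>x\<bar> powr (1 / k) \<le> (\<bar>\<phi> x\<bar> powr k) powr (1 / k)"
      using k by (intro powr_mono2) auto
    then show ?thesis
      using k ge1 by (simp add: powr_powr)
  qed
  then show "\<exists>k::real. k > 0 \<and> (\<forall>x. \<bar>x\<bar> \<ge> k \<longrightarrow> \<bar>\<phi> x\<bar> \<ge> \<bar>x\<bar> powr (1 / k))"
    using k by (intro exI[of _ k]) auto
next
  assume "\<exists>k::real. k > 0 \<and> (\<forall>x. \<bar>x\<bar> \<ge> k \<longrightarrow> \<bar>\<phi> x\<bar> \<ge> \<bar>x\<bar> powr (1 / k))"
  then obtain k :: real where k: "k > 0" "\<And>x. \<bar>x\<bar> \<ge> k \<Longrightarrow> \<bar>\<phi> x\<bar> \<ge> \<bar>x\<bar> powr (1 / k)"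
    by blast
  \<comment> \<open>The factor k + 1 covers |x| < k, where the hypothesis says nothing.\<close>
  have "\<bar>x\<bar> \<le> (k + 1) * (1 + \<bar>\<phi> x\<bar>\<^sup>2) powr k" for x
  proof (cases "\<bar>x\<bar> \<ge> k")
    case True
    have "\<bar>x\<bar> = (\<bar>x\<bar> powr (1 / k)) powr k"
      using k(1) by (simp add: powr_powr)
    also have "\<dots> \<le> (1 + \<bar>\<phi> x\<bar>\<^sup>2) powr k"
      using k(1) abs_le_one_plus_square[of "\<phi> x"] by (intro powr_mono2 order_trans[OF k(2)[OF True]]) auto
    also have "\<dots> \<le> (k + 1) * (1 + \<bar>\<phi> x\<bar>\<^sup>2) powr k"
      using k(1) by (simp add: distrib_right)
    finally show ?thesis .
  next
    case False
    then have "\<bar>x\<bar> \<le> (k + 1) * 1"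
      by simp
    also have "\<dots> \<le> (k + 1) * (1 + \<bar>\<phi> x\<bar>\<^sup>2) powr k"
      using k(1) by (intro mult_left_mono ge_one_powr_ge_zero) auto
    finally show ?thesis .
  qed
  then show "poly_bounded \<phi> (\<lambda>x. x)"
    unfolding poly_bounded_iff_powr using k(1) by (intro exI[of _ "k + 1"] exI[of _ k]) auto
qed

section \<open>Necessity\<close>

lemma higher_deriv_bounded_on_interval:
  assumes "f \<in> smooth_functions"
  obtains C where "\<And>x. \<bar>x\<bar> \<le> a \<Longrightarrow> \<bar>(deriv ^^ j) f x\<bar> \<le> C"
proof -
  have "compact ((deriv ^^ j) f ` {-a..a})"
    by (intro compact_continuous_image smooth_continuous_on smooth_higher_deriv assms) simp
  then obtain C where "\<forall>y\<in>(deriv ^^ j) f ` {-a..a}. norm y \<le> C"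
    using compact_imp_bounded bounded_iff by metis
  then show thesis
    by (intro that[of C]) (auto simp: abs_le_iff)
qed

lemma schwartz_compact_support:
  assumes "f \<in> smooth_functions" "\<And>x. \<bar>x\<bar> \<ge> a \<Longrightarrow> f x = 0"
  shows "f \<in> schwartz_space"
proof -
  have "\<exists>C. \<forall>x. (1 + x\<^sup>2) ^ n * \<bar>(deriv ^^ j) f x\<bar> \<le> C" for n j
  proof -
    obtain C where C: "\<And>x. \<bar>x\<bar> \<le> a \<Longrightarrow> \<bar>(deriv ^^ j) f x\<bar> \<le> C"
      using higher_deriv_bounded_on_interval[OF assms(1)] by metis
    have "(1 + x\<^sup>2) ^ n * \<bar>(deriv ^^ j) f x\<bar> \<le> (1 + a\<^sup>2) ^ n * \<bar>C\<bar>" for x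
    proof (cases "\<bar>x\<bar> \<le> a")
      case True
      have "x\<^sup>2 \<le> a\<^sup>2"
        using True by (intro abs_le_square_iff[THEN iffD1]) auto
      then show ?thesis
        using C[OF True] by (intro mult_mono power_mono) auto
    next
      case False
      have "open {x::real. a < \<bar>x\<bar>}"
        by (intro open_Collect_less continuous_intros)
      then have "(deriv ^^ j) f x = (deriv ^^ j) (\<lambda>x. 0) x"
        by (rule higher_deriv_cong_open) (use False assms(2) in auto)
      then show ?thesis
        by (simp add: higher_deriv_const)
    qed
    then show ?thesis
      by blast
  qed
  then show ?thesis
    using assms(1) by (simp add: schwartz_space_iff)
qed

text \<open>Bumps have radius 2 and centres lie 5 apart, so within 3 of a centre only its own bump
  acts, and a point at distance at least 3 from all centres has a unit ball on which
  \<open>f\<close> vanishes. Everything is thus local. For a fixed weight n, \<open>decay\<close>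
  handles all bumps with m \<ge> n; the finitely many others enter the constant.\<close>

lemma schwartz_separated_bumps:
  fixes s c :: "nat \<Rightarrow> real"
  assumes \<psi>: "\<psi> \<in> smooth_functions" "\<And>x. \<bar>x\<bar> \<ge> 2 \<Longrightarrow> \<psi> x = 0"
    and sep: "\<And>m n. m \<noteq> n \<Longrightarrow> \<bar>s m - s n\<bar> \<ge> 5"
    and decay: "\<And>m. \<bar>c m\<bar> * (1 + (s m)\<^sup>2) ^ m \<le> 1"
  obtains f where "f \<in> schwartz_space"
    "\<And>m t. \<bar>t - s m\<bar> < 3 \<Longrightarrow> f t = c m * \<psi> (t - s m)"
proof -
  \<comment> \<open>The index set has at most one element, so no convergence question
    arises.\<close>
  define f where "f t = (\<Sum>m | \<bar>t - s m\<bar> < 2. c m * \<psi> (t - s m))" for t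
  have near: "f t = c m * \<psi> (t - s m)" if "\<bar>t - s m\<bar> < 3" for t m
  proof -
    have uniq: "i = m" if "\<bar>t - s i\<bar> < 2" for i
      using sep[of i m] that \<open>\<bar>t - s m\<bar> < 3\<close> by (cases "i = m") auto
    have "{i. \<bar>t - s i\<bar> < 2} = (if \<bar>t - s m\<bar> < 2 then {m} else {})"
    proof (cases "\<bar>t - s m\<bar> < 2")
      case True
      then have "{i. \<bar>t - s i\<bar> < 2} = {m}"
        using uniq by blast
      then show ?thesis
        using True by (simp only: if_True)
    next
      case False
      then have "{i. \<bar>t - s i\<bar> < 2} = {}"
        using uniq by blast
      then show ?thesis
        using False by (simp only: if_False)
    qed
    then show ?thesis
      using \<psi>(2)[of "t - s m"] by (simp add: f_def)
  qed
  have far: "f t' = 0" if "\<And>m. \<bar>t - s m\<bar> \<ge> 3" "t' \<in> ball t 1" for t t'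
  proof -
    have "\<bar>t' - s i\<bar> \<ge> 2" for i
      using that(1)[of i] that(2) by (auto simp: dist_real_def)
    then have "{i. \<bar>t' - s i\<bar> < 2} = {}"
      by (auto simp: not_less)
    then show ?thesis
      by (simp add: f_def)
  qed
  have shift: "(\<lambda>t. c m * \<psi> (t - s m)) \<in> smooth_functions" for m
    using smooth_mult[OF smooth_const smooth_compose[OF \<psi>(1) smooth_affine[of 1 "- s m"]]] by simp
  have "f \<in> smooth_functions"
  proof (rule smooth_local)
    fix t
    show "\<exists>g\<in>smooth_functions. \<forall>\<^sub>F y in nhds t. f y = g y"
    proof (cases "\<exists>m. \<bar>t - s m\<bar> < 3")
      case True
      then obtain m where "t \<in> ball (s m) 3"
        by (auto simp: dist_real_def abs_minus_commute)
      then have "\<forall>\<^sub>F y in nhds t. y \<in> ball (s m) 3"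
        by (intro eventually_nhds_in_open) auto
      then have "\<forall>\<^sub>F y in nhds t. f y = c m * \<psi> (y - s m)"
        by eventually_elim (auto simp: dist_real_def abs_minus_commute intro!: near)
      then show ?thesis
        by (rule bexI[OF _ shift])
    next
      case False
      then have "f y = 0" if "y \<in> ball t 1" for y
        using far[of t y] that by (auto simp: not_less)
      moreover have "\<forall>\<^sub>F y in nhds t. y \<in> ball t 1"
        by (intro eventually_nhds_in_open) auto
      ultimately have "\<forall>\<^sub>F y in nhds t. f y = 0"
        by (auto elim: eventually_mono)
      then show ?thesis
        by (rule bexI[OF _ smooth_const])
    qed
  qed
  moreover have "\<exists>C. \<forall>t. (1 + t\<^sup>2) ^ n * \<bar>(deriv ^^ j) f t\<bar> \<le> C" for n j
  proof -
    define A where "A = 1 + (\<Sum>i<n. \<bar>c i\<bar> * (1 + (s i)\<^sup>2) ^ n)"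
    have S: "(\<Sum>i<n. \<bar>c i\<bar> * (1 + (s i)\<^sup>2) ^ n) \<ge> 0"
      by (intro sum_nonneg) auto
    have A: "\<bar>c m\<bar> * (1 + (s m)\<^sup>2) ^ n \<le> A" for m
    proof (cases "m < n")
      case True
      then have "\<bar>c m\<bar> * (1 + (s m)\<^sup>2) ^ n \<le> (\<Sum>i<n. \<bar>c i\<bar> * (1 + (s i)\<^sup>2) ^ n)"
        by (intro member_le_sum) auto
      then show ?thesis
        by (simp add: A_def)
    next
      case False
      then have "\<bar>c m\<bar> * (1 + (s m)\<^sup>2) ^ n \<le> \<bar>c m\<bar> * (1 + (s m)\<^sup>2) ^ m"
        by (intro mult_left_mono power_increasing) auto
      then show ?thesis
        using decay[of m] S by (simp add: A_def)
    qed
    obtain B where B: "\<And>x. \<bar>x\<bar> \<le> 3 \<Longrightarrow> \<bar>(deriv ^^ j) \<psi> x\<bar> \<le> B"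
      using higher_deriv_bounded_on_interval[OF \<psi>(1)] by metis
    have B0: "B \<ge> 0"
      using B[of 0] by simp
    have "(1 + t\<^sup>2) ^ n * \<bar>(deriv ^^ j) f t\<bar> \<le> 19 ^ n * A * B" for t
    proof (cases "\<exists>m. \<bar>t - s m\<bar> < 3")
      case True
      then obtain m where m: "\<bar>t - s m\<bar> < 3"
        by blast
      then have "(deriv ^^ j) f t = (deriv ^^ j) (\<lambda>t. c m * \<psi> (t - s m)) t"
        by (intro higher_deriv_cong_open[of "ball (s m) 3"])
          (auto simp: dist_real_def abs_minus_commute intro!: near)
      also have "\<dots> = c m * (deriv ^^ j) \<psi> (t - s m)"
        by (simp add: higher_deriv_shift[OF \<psi>(1)])
      finally have eq: "\<bar>(deriv ^^ j) f t\<bar> = \<bar>c m\<bar> * \<bar>(deriv ^^ j) \<psi> (t - s m)\<bar>"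
        by (simp add: abs_mult)
      have "(t - s m)\<^sup>2 \<le> 9"
        using m abs_le_square_iff[of "t - s m" 3] by simp
      \<comment> \<open>The right side minus the left is (t - 2 s)^2. With (t - s)^2 \<le> 9 this
        gives 1 + t^2 \<le> 19 + 2 s^2, the origin of 19.\<close>
      moreover have "t\<^sup>2 \<le> 2 * (t - s m)\<^sup>2 + 2 * (s m)\<^sup>2"
        using zero_le_power2[of "t - 2 * s m"] by (simp add: power2_eq_square algebra_simps)
      ultimately have "1 + t\<^sup>2 \<le> 19 * (1 + (s m)\<^sup>2)"
        using zero_le_power2[of "s m"] by (simp only: distrib_left)
      then have "(1 + t\<^sup>2) ^ n \<le> (19 * (1 + (s m)\<^sup>2)) ^ n"
        by (intro power_mono) auto
      then have "(1 + t\<^sup>2) ^ n * \<bar>(deriv ^^ j) f t\<bar>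
          \<le> (19 ^ n * (1 + (s m)\<^sup>2) ^ n) * (\<bar>c m\<bar> * B)"
        unfolding eq power_mult_distrib
        using m B[of "t - s m"] by (intro mult_mono) auto
      also have "\<dots> = 19 ^ n * (\<bar>c m\<bar> * (1 + (s m)\<^sup>2) ^ n) * B"
        by (simp add: mult_ac)
      also have "\<dots> \<le> 19 ^ n * A * B"
        using B0 by (intro mult_right_mono mult_left_mono A) auto
      finally show ?thesis .
    next
      case False
      then have "(deriv ^^ j) f t = (deriv ^^ j) (\<lambda>t. 0) t"
        by (intro higher_deriv_cong_open[of "ball t 1"] far) (auto simp: not_less)
      then show ?thesis
        using B0 S by (simp add: higher_deriv_const A_def)
    qed
    then show ?thesis
      by blast
  qed
  ultimately have "f \<in> schwartz_space"
    by (simp add: schwartz_space_iff)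
  with near show thesis
    by (rule that[rotated])
qed

text \<open>The function \<open>q\<close> is a local profile: \<open>q = 1\<close> makes \<open>f \<circ> \<phi>\<close> take the value \<open>c\<close> at \<open>x\<close>, and
  \<open>q t = t\<close> makes every derivative of \<open>f \<circ> \<phi>\<close> of positive order at \<open>x\<close> equal to \<open>c\<close> times the
  derivative of \<open>\<phi>\<close>. If \<open>\<phi>\<close> is bounded along the points where \<open>g\<close> is large, one cut-off of \<open>q\<close>
  suffices; otherwise the points can be chosen with separated \<open>\<phi>\<close>-values.\<close>

lemma schwartz_witness_not_poly_bounded:
  assumes q: "q \<in> smooth_functions" and g: "\<not> poly_bounded \<phi> g"
  obtains f where "f \<in> schwartz_space"
    "\<And>K. \<exists>x c b. c > 0 \<and> \<bar>g x\<bar> * c > K \<and> (\<forall>\<^sub>F t in nhds (\<phi> x). f t = c * q (t - b))"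
proof -
  \<comment> \<open>One index is both constant and exponent, so the condition sharpens as
    \<open>m\<close> grows.\<close>
  define Q where "Q m x \<longleftrightarrow> \<bar>g x\<bar> > real m * (1 + (\<phi> x)\<^sup>2) ^ m" for m x
  have ex: "\<exists>x. Q m x" for m
    using g unfolding Q_def poly_bounded_def by (meson not_le)
  have mono: "Q m x" if "Q n x" "m \<le> n" for m n x
  proof -
    have "real m * (1 + (\<phi> x)\<^sup>2) ^ m \<le> real n * (1 + (\<phi> x)\<^sup>2) ^ n"
      using that(2) by (intro mult_mono power_increasing) auto
    then show ?thesis
      using that(1) by (simp add: Q_def)
  qed
  show thesis
  proof (cases "\<exists>M m. \<forall>x. Q m x \<longrightarrow> \<bar>\<phi> x\<bar> \<le> M")
    case True
    then obtain M m0 where M: "\<And>x. Q m0 x \<Longrightarrow> \<bar>\<phi> x\<bar> \<le> M"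
      by blast
    \<comment> \<open>Radius M + 1 makes \<open>P\<close> equal to 1 on a whole neighbourhood of
      each value in [-M, M].\<close>
    obtain P where P: "P \<in> smooth_functions" "\<And>x. \<bar>x\<bar> \<le> M + 1 \<Longrightarrow> P x = 1"
      "\<And>x. \<bar>x\<bar> \<ge> M + 1 + 1 \<Longrightarrow> P x = 0"
      using smooth_plateau_exists[of "M + 1"] by metis
    show thesis
    proof (rule that)
      show "(\<lambda>t. q t * P t) \<in> schwartz_space"
        by (rule schwartz_compact_support[of _ "M + 1 + 1"]) (auto simp: P(3) intro: smooth_mult q P(1))
      fix K :: real
      obtain n where n: "K \<le> real n"
        using real_arch_simple by blast
      \<comment> \<open>\<open>m0\<close> confines \<phi> x to [-M, M]; \<open>n\<close> makes |g x|
        exceed K.\<close>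
      obtain x where x: "Q (max m0 n) x"
        using ex by blast
      have "\<forall>\<^sub>F t in nhds (\<phi> x). t \<in> {- (M + 1)<..<M + 1}"
        using M[OF mono[OF x]] by (intro eventually_nhds_in_open) auto
      then have "\<forall>\<^sub>F t in nhds (\<phi> x). q t * P t = 1 * q (t - 0)"
        by eventually_elim (use P(2) in \<open>simp add: abs_le_iff\<close>)
      moreover have "real n * 1 \<le> real n * (1 + (\<phi> x)\<^sup>2) ^ n"
        by (intro mult_left_mono one_le_power) auto
      then have "\<bar>g x\<bar> * 1 > K"
        using mono[OF x, of n] n by (simp add: Q_def)
      ultimately show "\<exists>x c b. c > 0 \<and> \<bar>g x\<bar> * c > K \<and> (\<forall>\<^sub>F t in nhds (\<phi> x). q t * P t = c * q (t - b))"
        using zero_less_one by blast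
    qed
  next
    case False
    have step: "\<exists>x. Q m x \<and> M < \<bar>\<phi> x\<bar>" for m M
      using False by (meson not_le)
    \<comment> \<open>Making the absolute values jump by 5 separates the values of \<phi> whatever
      their signs.\<close>
    have "\<exists>y. \<forall>m. Q m (y m) \<and> \<bar>\<phi> (y m)\<bar> + 5 \<le> \<bar>\<phi> (y (Suc m))\<bar>"
      using ex step by (intro dependent_nat_choice) (auto, meson less_imp_le)
    then obtain y where y: "\<And>m. Q m (y m)" "\<And>m. \<bar>\<phi> (y m)\<bar> + 5 \<le> \<bar>\<phi> (y (Suc m))\<bar>"
      by blast
    have less: "\<bar>\<phi> (y m)\<bar> + 5 \<le> \<bar>\<phi> (y n)\<bar>" if "m < n" for m n
      using that
    proof (induction n)
      case (Suc n)
      then show ?case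
        using y(2)[of n] by (cases "m = n") auto
    qed auto
    have sep: "\<bar>\<phi> (y m) - \<phi> (y n)\<bar> \<ge> 5" if "m \<noteq> n" for m n
      using that less[of m n] less[of n m] by (cases m n rule: linorder_cases) auto
    \<comment> \<open>This is the largest height the decay condition allows; the factor
      \<open>m\<close> in \<open>Q m\<close> survives, giving |g (y m)| c m > m.\<close>
    define c where "c m = inverse ((1 + (\<phi> (y m))\<^sup>2) ^ m)" for m
    have pos: "(1 + (\<phi> (y m))\<^sup>2) ^ m > 0" for m
      by (intro zero_less_power add_pos_nonneg) auto
    have c: "\<bar>c m\<bar> * (1 + (\<phi> (y m))\<^sup>2) ^ m \<le> 1" "c m > 0" for m
      using pos[of m] by (auto simp: c_def left_inverse[OF less_imp_neq[OF pos, symmetric]])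
    obtain P where P: "P \<in> smooth_functions" "\<And>x. \<bar>x\<bar> \<le> 1 \<Longrightarrow> P x = 1" "\<And>x. \<bar>x\<bar> \<ge> 2 \<Longrightarrow> P x = 0"
      using smooth_plateau_exists[of 1] by (metis one_add_one)
    obtain f where f: "f \<in> schwartz_space"
      "\<And>m t. \<bar>t - \<phi> (y m)\<bar> < 3 \<Longrightarrow> f t = c m * (q (t - \<phi> (y m)) * P (t - \<phi> (y m)))"
      using schwartz_separated_bumps[of "\<lambda>t. q t * P t" "\<lambda>m. \<phi> (y m)" c,
          OF smooth_mult[OF q P(1)] _ sep c(1)] P(3) by auto
    show thesis
    proof (rule that[OF f(1)])
      fix K :: real
      obtain m where m: "K \<le> real m"
        using real_arch_simple by blast
      have "\<forall>\<^sub>F t in nhds (\<phi> (y m)). t \<in> ball (\<phi> (y m)) 1"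
        by (intro eventually_nhds_in_open) auto
      then have "\<forall>\<^sub>F t in nhds (\<phi> (y m)). f t = c m * q (t - \<phi> (y m))"
        by eventually_elim (auto simp: f(2)[of _ m] P(2) dist_real_def abs_minus_commute)
      moreover have "real m < \<bar>g (y m)\<bar> / (1 + (\<phi> (y m))\<^sup>2) ^ m"
        using y(1)[of m] pos[of m] unfolding Q_def by (simp only: pos_less_divide_eq)
      then have "\<bar>g (y m)\<bar> * c m > K"
        unfolding c_def divide_inverse using m by linarith
      ultimately show "\<exists>x c b. c > 0 \<and> \<bar>g x\<bar> * c > K \<and> (\<forall>\<^sub>F t in nhds (\<phi> x). f t = c * q (t - b))"
        using c(2) by blast
    qed
  qed
qed

text \<open>The constant profile gives f(\<phi> x) = c with |x| c arbitrarily large, whereas the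
  weight 1 + x^2 \<ge> |x| keeps |x| c bounded.\<close>

lemma schwartz_symbol_poly_bounded_ident:
  assumes "schwartz_symbol \<phi>"
  shows "poly_bounded \<phi> (\<lambda>x. x)"
proof (rule ccontr)
  assume "\<not> ?thesis"
  then obtain f where f: "f \<in> schwartz_space"
    "\<And>K. \<exists>x c b. c > 0 \<and> \<bar>x\<bar> * c > K \<and> (\<forall>\<^sub>F t in nhds (\<phi> x). f t = c * 1)"
    using schwartz_witness_not_poly_bounded[OF smooth_const[of 1]] by metis
  have "f \<circ> \<phi> \<in> schwartz_space"
    using assms f(1) by (simp add: schwartz_symbol_def)
  then obtain C where "\<forall>x. (1 + x\<^sup>2) ^ 1 * \<bar>(deriv ^^ 0) (f \<circ> \<phi>) x\<bar> \<le> C"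
    unfolding schwartz_space_iff by blast
  then have C: "(1 + x\<^sup>2) * \<bar>f (\<phi> x)\<bar> \<le> C" for x
    by simp
  obtain x c where x: "c > 0" "\<bar>x\<bar> * c > C" "\<forall>\<^sub>F t in nhds (\<phi> x). f t = c"
    using f(2)[of C] by auto
  have "f (\<phi> x) = c"
    using x(3) by (rule eventually_nhds_x_imp_x)
  then have "(1 + x\<^sup>2) * c \<le> C"
    using C[of x] x(1) by simp
  moreover have "\<bar>x\<bar> * c \<le> (1 + x\<^sup>2) * c"
    using x(1) by (intro mult_right_mono abs_le_one_plus_square) auto
  ultimately show False
    using x(2) by linarith
qed

text \<open>An affine profile turns f o \<phi> into c (\<phi> - b) near x, so the chain rule
  produces no other derivatives of \<phi>. The order 0 is separate: the shift b vanishes only under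
  differentiation, and |\<phi>| \<le> 1 + \<phi>^2 settles that case.\<close>

lemma schwartz_symbol_poly_bounded_higher_deriv:
  assumes "schwartz_symbol \<phi>"
  shows "poly_bounded \<phi> ((deriv ^^ j) \<phi>)"
proof (cases "j = 0")
  case True
  show ?thesis
    unfolding poly_bounded_def True
    by (intro exI[of _ 1] exI[of _ 1]) (simp add: abs_le_one_plus_square)
next
  case False
  have \<phi>: "\<phi> \<in> smooth_functions"
    using assms by (simp add: schwartz_symbol_def)
  show ?thesis
  proof (rule ccontr)
    assume "\<not> ?thesis"
    then obtain f where f: "f \<in> schwartz_space"
      "\<And>K. \<exists>x c b. c > 0 \<and> \<bar>(deriv ^^ j) \<phi> x\<bar> * c > K \<and> (\<forall>\<^sub>F t in nhds (\<phi> x). f t = c * (t - b))"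
      by (rule schwartz_witness_not_poly_bounded[OF smooth_ident]) (assumption | rule that)+
    have "f \<circ> \<phi> \<in> schwartz_space"
      using assms f(1) by (simp add: schwartz_symbol_def)
    then obtain C where "\<forall>x. (1 + x\<^sup>2) ^ 0 * \<bar>(deriv ^^ j) (f \<circ> \<phi>) x\<bar> \<le> C"
      unfolding schwartz_space_iff by blast
    then have C: "\<bar>(deriv ^^ j) (f \<circ> \<phi>) x\<bar> \<le> C" for x
      by simp
    obtain x c b where x: "c > 0" "\<bar>(deriv ^^ j) \<phi> x\<bar> * c > C"
      "\<forall>\<^sub>F t in nhds (\<phi> x). f t = c * (t - b)"
      using f(2)[of C] by blast
    obtain V where V: "open V" "\<phi> x \<in> V" "\<And>t. t \<in> V \<Longrightarrow> f t = c * (t - b)"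
      using x(3) by (auto simp: eventually_nhds)
    have "open (\<phi> -` V)"
      using V(1) smooth_continuous_on[OF \<phi>] by (simp add: open_vimage)
    then have "(deriv ^^ j) (f \<circ> \<phi>) x = (deriv ^^ j) (\<lambda>x. c * \<phi> (x - 0) + (- (c * b))) x"
      by (rule higher_deriv_cong_open) (use V(2) in \<open>auto simp: V(3) right_diff_distrib\<close>)
    also have "\<dots> = (deriv ^^ j) (\<lambda>x. c * \<phi> (x - 0)) x"
      using False \<phi> smooth_mult[OF smooth_const \<phi>]
      by (subst higher_deriv_add) (simp_all add: smooth_const higher_deriv_const)
    also have "\<dots> = c * (deriv ^^ j) \<phi> x"
      by (subst higher_deriv_shift[OF \<phi>]) simp
    finally show False
      using C[of x] x by (simp add: abs_mult mult.commute)
  qed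
qed

theorem theorem2p3:
  fixes \<phi> :: "real \<Rightarrow> real"
  assumes "\<phi> \<in> smooth_functions"
  shows "schwartz_symbol \<phi> \<longleftrightarrow>
    (\<forall>j::nat. \<exists>C p :: real. C > 0 \<and> p > 0 \<and>
       (\<forall>x. \<bar>(deriv ^^ j) \<phi> x\<bar> \<le> C * (1 + \<bar>\<phi> x\<bar>\<^sup>2) powr p)) \<and>
    (\<exists>k::real. k > 0 \<and> (\<forall>x. \<bar>x\<bar> \<ge> k \<longrightarrow> \<bar>\<phi> x\<bar> \<ge> \<bar>x\<bar> powr (1 / k)))"
  unfolding poly_bounded_iff_powr[symmetric] poly_bounded_ident_iff[symmetric]
proof
  assume "schwartz_symbol \<phi>"
  then show "(\<forall>j. poly_bounded \<phi> ((deriv ^^ j) \<phi>)) \<and> poly_bounded \<phi> (\<lambda>x. x)"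
    by (simp add: schwartz_symbol_poly_bounded_higher_deriv schwartz_symbol_poly_bounded_ident)
next
  assume "(\<forall>j. poly_bounded \<phi> ((deriv ^^ j) \<phi>)) \<and> poly_bounded \<phi> (\<lambda>x. x)"
  then show "schwartz_symbol \<phi>"
    by (intro schwartz_symbolI assms) auto
qed

end
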